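(* Let $\mathcal{S}^{d-1}$ denote the unit sphere in $\mathbb{R}^d$. For any $0 < \varepsilon \leq 1$, any integer $k \geq 1$, and any dataset $X \subseteq \mathbb{R}^d$ with $n$ points, there exists a set $\xi \subseteq \mathbb{R}^d$ of size $O\left(\frac{\mathcal{N}(\mathcal{S}^{d-1}, \sqrt{\varepsilon/2}) \cdot k \cdot \log n}{\sqrt{\varepsilon}}\right)$ such that $\Phi(\xi, X) \leq \varepsilon \cdot \Delta_k(X)$.
   Context: For a finite set of centers $C \subseteq \mathbb{R}^d$ and a finite dataset $X \subseteq \mathbb{R}^d$, $\Phi(C, X) = \sum_{x \in X} \min_{c \in C} \|x - c\|^2$. $\Delta_k(X)$ denotes the optimal $k$-means cost, i.e. the minimum of $\Phi(C, X)$ over all sets $C \subseteq \mathbb{R}^d$ of $k$ centers. For a metric space $(\mathcal{X}, D)$ and $\delta > 0$, a set $S \subseteq \mathcal{X}$ is a $\delta$-covering set if every $x \in \mathcal{X}$ has some $s \in S$ with $D(x, s) \leq \delta$; the covering number $\mathcal{N}(\mathcal{X}, \delta)$ is the minimum cardinality of a $\delta$-covering set. Here $\mathcal{S}^{d-1}$ carries the Euclidean distance. The big-O hides only a fixed universal constant.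
   Formalization: The dataset is assumed to have n ≥ 2 points (and d ≥ 1): for n = 1 the bound contains log n = 0, which would force ξ to be empty so that Φ(ξ, X) is undefined, and for n = 0 log n is undefined. *)

theory Defs
  imports "HOL-Analysis.Analysis"
begin

(* The dimension d is a natural number, not a type, so that one constant can be asserted for all
   dimensions at once: R^d is the set of f :: nat => real with f i = 0 for all i >= d, the
   carrier of the library topology Euclidean_space d.  The distance must be l2_dist: the
   type class distance on nat => real (Function_Metric) is a different metric. *)

abbreviation Rn :: "nat \<Rightarrow> (nat \<Rightarrow> real) set" where
  "Rn d \<equiv> topspace (Euclidean_space d)"

definition l2_norm :: "nat \<Rightarrow> (nat \<Rightarrow> real) \<Rightarrow> real" where
  "l2_norm d x = L2_set x {..<d}"

definition l2_dist :: "nat \<Rightarrow> (nat \<Rightarrow> real) \<Rightarrow> (nat \<Rightarrow> real) \<Rightarrow> real" where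
  "l2_dist d x y = l2_norm d (\<lambda>i. x i - y i)"

lemma Metric_space_l2_dist: "Metric_space (Rn d) (l2_dist d)"
proof
  fix x y z
  show "0 \<le> l2_dist d x y"
    by (simp add: l2_dist_def l2_norm_def L2_set_nonneg)
  show "l2_dist d x y = l2_dist d y x"
    by (simp add: l2_dist_def l2_norm_def L2_set_def power2_commute)
  show "l2_dist d x y = 0 \<longleftrightarrow> x = y" if "x \<in> Rn d" "y \<in> Rn d"
  proof
    assume "l2_dist d x y = 0"
    then have "x i = y i" if "i < d" for i
      using that by (simp add: l2_dist_def l2_norm_def L2_set_eq_0_iff)
    moreover have "x i = y i" if "d \<le> i" for i
      using that \<open>x \<in> Rn d\<close> \<open>y \<in> Rn d\<close> by (simp add: topspace_Euclidean_space)
    ultimately show "x = y"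
      by (metis ext not_le)
  qed (simp add: l2_dist_def l2_norm_def L2_set_def)
  show "l2_dist d x z \<le> l2_dist d x y + l2_dist d y z"
    using L2_set_triangle_ineq[of "\<lambda>i. x i - y i" "\<lambda>i. y i - z i" "{..<d}"]
    by (simp add: l2_dist_def l2_norm_def)
qed

(* The sphere S^(d-1) inside R^d. *)
definition unit_sphere :: "nat \<Rightarrow> (nat \<Rightarrow> real) set" where
  "unit_sphere d = {x \<in> Rn d. l2_norm d x = 1}"

definition covering_set :: "'a set \<Rightarrow> ('a \<Rightarrow> 'a \<Rightarrow> real) \<Rightarrow> real \<Rightarrow> 'a set \<Rightarrow> bool" where
  "covering_set M D \<delta> S \<longleftrightarrow> S \<subseteq> M \<and> (\<forall>x\<in>M. \<exists>s\<in>S. D x s \<le> \<delta>)"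

(* Meaningful for totally bounded (M, D), such as the sphere.  If no finite covering
   set exists, this is Inf {} = 0. *)
definition covering_number :: "'a set \<Rightarrow> ('a \<Rightarrow> 'a \<Rightarrow> real) \<Rightarrow> real \<Rightarrow> nat" where
  "covering_number M D \<delta> = Inf (card ` {S. finite S \<and> covering_set M D \<delta> S})"

(* Only meaningful for finite nonempty C, because Min {} is unspecified. *)
definition kmeans_cost :: "nat \<Rightarrow> (nat \<Rightarrow> real) set \<Rightarrow> (nat \<Rightarrow> real) set \<Rightarrow> real" where
  "kmeans_cost d C X = (\<Sum>x\<in>X. Min ((\<lambda>c. (l2_dist d x c)\<^sup>2) ` C))"

(* The infimum is attained for finite X, d >= 1 and k >= 1, so this is the minimum. *)
definition opt_kmeans_cost :: "nat \<Rightarrow> nat \<Rightarrow> (nat \<Rightarrow> real) set \<Rightarrow> real" where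
  "opt_kmeans_cost d k X = Inf {kmeans_cost d C X | C. C \<subseteq> Rn d \<and> finite C \<and> card C = k}"

end

theory Submission
  imports Defs
begin

text \<open>
  Start from \<open>k\<close> centers whose cost is within a factor \<open>6/5\<close> of the optimum \<open>\<Delta>\<close>, and surround each of
  them by spheres of radii \<open>R * b ^ j\<close>, where \<open>R\<^sup>2 = \<epsilon> * \<Delta> / (4 * n)\<close> and \<open>b = 1 + sqrt \<epsilon> / 3\<close>, each
  carrying a scaled copy of an optimal \<open>sqrt (\<epsilon> / 2)\<close>-covering of the unit sphere.  Points closer
  than \<open>R\<close> to their center cost at most \<open>\<epsilon> * \<Delta> / 4\<close> together.  A point at distance \<open>r \<ge> R\<close> is
  served by the largest sphere of radius \<open>\<rho> \<le> r\<close>: since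
  \<open>|r u - \<rho> s|\<^sup>2 = (r - \<rho>)\<^sup>2 + r \<rho> |u - s|\<^sup>2\<close> for unit vectors, its cost is at most \<open>5/8 * \<epsilon> * r\<^sup>2\<close>.
  If \<open>\<epsilon> > 1 / n\<^sup>2\<close>, then \<open>O(ln n / sqrt \<epsilon>)\<close> radii suffice.  If \<open>\<epsilon> \<le> 1 / n\<^sup>2\<close>, or if \<open>n \<le> k\<close>
  (where \<open>\<Delta>\<close> may be \<open>0\<close>), already \<open>\<xi> = X\<close> is small enough.
\<close>

section \<open>Coordinates and Euclidean distance\<close>

lemma l2_dist_nonneg: "0 \<le> l2_dist d x y"
  by (simp add: l2_dist_def l2_norm_def L2_set_nonneg)

lemma l2_dist_square: "(l2_dist d x y)\<^sup>2 = (\<Sum>i<d. (x i - y i)\<^sup>2)"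
  by (simp add: l2_dist_def l2_norm_def L2_set_def sum_nonneg)

lemma l2_norm_square: "(l2_norm d x)\<^sup>2 = (\<Sum>i<d. (x i)\<^sup>2)"
  by (simp add: l2_norm_def L2_set_def sum_nonneg)

lemma in_Rn_iff: "x \<in> Rn d \<longleftrightarrow> (\<forall>i\<ge>d. x i = 0)"
  by (simp add: topspace_Euclidean_space)

lemma infinite_Rn:
  assumes "d \<ge> 1"
  shows "infinite (Rn d)"
proof -
  let ?f = "\<lambda>m i. if i = 0 then real m else 0"
  have "inj ?f"
    by (auto simp: inj_def fun_eq_iff)
  then have "infinite (range ?f)"
    using finite_imageD infinite_UNIV_nat by blast
  moreover have "range ?f \<subseteq> Rn d"
    using assms by (auto simp: in_Rn_iff)
  ultimately show ?thesis
    using finite_subset by blast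
qed

section \<open>Finite coverings of the unit sphere\<close>

lemma unit_sphere_nonempty:
  assumes "d \<ge> 1"
  shows "unit_sphere d \<noteq> {}"
proof -
  let ?e = "\<lambda>i::nat. if i = 0 then 1 else (0::real)"
  have "(\<Sum>i<d. (?e i)\<^sup>2) = (\<Sum>i<d. if i = 0 then 1 else 0)"
    by (rule sum.cong) auto
  also have "\<dots> = 1"
    using assms by simp
  finally have "l2_norm d ?e = 1"
    by (simp add: l2_norm_def L2_set_def)
  moreover have "?e \<in> Rn d"
    using assms by (auto simp: in_Rn_iff)
  ultimately show ?thesis
    by (auto simp: unit_sphere_def)
qed

text \<open>Rounding coordinates to a grid of width \<open>1 / M\<close> splits the sphere into
  finitely many cells. Two points of one cell differ by at most \<open>1 / M\<close> in each
  coordinate, hence by at most \<open>d / M \<le> \<delta>\<close> in the sum of absolute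
  differences, which dominates the Euclidean distance.\<close>

lemma finite_covering_unit_sphere:
  assumes "\<delta> > 0"
  shows "\<exists>S. finite S \<and> covering_set (unit_sphere d) (l2_dist d) \<delta> S"
proof -
  obtain m :: nat where m: "real d / \<delta> < real m"
    using reals_Archimedean2 by blast
  define M where "M = real m + 1"
  have M: "M > 0" "real d \<le> \<delta> * M"
    using m assms by (auto simp: M_def field_simps)
  \<comment> \<open>The restriction to \<open>{..<d}\<close> makes \<open>g x\<close> extensional,
    so that all cell labels lie in a finite \<open>PiE\<close>.\<close>
  define g where "g x = (\<lambda>i\<in>{..<d}. \<lfloor>x i * M\<rfloor>)" for x :: "nat \<Rightarrow> real"
  have "g ` unit_sphere d \<subseteq> {..<d} \<rightarrow>\<^sub>E {\<lfloor>-M\<rfloor>..\<lfloor>M\<rfloor>}"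
  proof (clarsimp simp: g_def PiE_iff unit_sphere_def)
    fix x i assume x: "l2_norm d x = 1" and i: "i < d"
    have "\<bar>x i\<bar> \<le> 1"
      using member_le_L2_set[of "{..<d}" i "\<lambda>i. \<bar>x i\<bar>"] x i
      by (simp add: l2_norm_def L2_set_def)
    then have "- M \<le> x i * M" "x i * M \<le> M"
      using M(1) mult_right_mono[of "-1" "x i" M] mult_right_mono[of "x i" 1 M]
      by (auto simp: abs_le_iff)
    then show "\<lfloor>-M\<rfloor> \<le> \<lfloor>x i * M\<rfloor> \<and> \<lfloor>x i * M\<rfloor> \<le> \<lfloor>M\<rfloor>"
      by (simp add: floor_mono)
  qed
  then have fin: "finite (g ` unit_sphere d)"
    by (rule finite_subset) (simp add: finite_PiE)
  \<comment> \<open>\<open>p\<close> picks a representative of each cell on the sphere itself,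
    because \<open>covering_set\<close> admits only points of the covered space; grid corners need
    not lie there.\<close>
  define p where "p = inv_into (unit_sphere d) g"
  show ?thesis
  proof (intro exI conjI)
    show "finite (p ` g ` unit_sphere d)"
      using fin by simp
    show "covering_set (unit_sphere d) (l2_dist d) \<delta> (p ` g ` unit_sphere d)"
      unfolding covering_set_def
    proof (intro conjI ballI)
      show "p ` g ` unit_sphere d \<subseteq> unit_sphere d"
        by (auto simp: p_def inv_into_into)
    next
      fix x assume x: "x \<in> unit_sphere d"
      define s where "s = p (g x)"
      have "g s = g x"
        unfolding s_def p_def using x by (simp add: f_inv_into_f)
      have "\<bar>x i - s i\<bar> \<le> 1 / M" if "i < d" for i
      proof -
        have "\<lfloor>s i * M\<rfloor> = \<lfloor>x i * M\<rfloor>"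
          using fun_cong[OF \<open>g s = g x\<close>, of i] that by (simp add: g_def)
        then have "\<bar>x i * M - s i * M\<bar> \<le> 1"
          by linarith
        then have "\<bar>x i - s i\<bar> * M \<le> 1"
          using M(1) by (simp flip: left_diff_distrib add: abs_mult)
        then show ?thesis
          using M(1) by (simp add: field_simps)
      qed
      then have "(\<Sum>i<d. \<bar>x i - s i\<bar>) \<le> real d * (1 / M)"
        using sum_bounded_above[of "{..<d}" "\<lambda>i. \<bar>x i - s i\<bar>" "1 / M"] by simp
      also have "\<dots> \<le> \<delta>"
        using M by (simp add: field_simps)
      finally have "l2_dist d x s \<le> \<delta>"
        using L2_set_le_sum_abs[of "\<lambda>i. x i - s i" "{..<d}"]
        by (simp add: l2_dist_def l2_norm_def)
      then show "\<exists>s\<in>p ` g ` unit_sphere d. l2_dist d x s \<le> \<delta>"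
        using x s_def by blast
    qed
  qed
qed

text \<open>One finite covering rules out the default value \<open>Inf {} = 0\<close>, and a
  nonempty set of naturals contains its infimum. The covering number thus becomes the size of a
  concrete set.\<close>

lemma covering_number_attained:
  assumes "finite S\<^sub>0" "covering_set M D \<delta> S\<^sub>0"
  obtains S where "finite S" "covering_set M D \<delta> S" "card S = covering_number M D \<delta>"
proof -
  have "Inf (card ` {S. finite S \<and> covering_set M D \<delta> S}) \<in> card ` {S. finite S \<and> covering_set M D \<delta> S}"
    by (rule Inf_nat_def1) (use assms in auto)
  then show thesis
    using that by (auto simp: covering_number_def)
qed

section \<open>Polar coordinates around a center\<close>

lemma l2_dist_scaled_square:
  assumes "l2_norm d u = 1" "l2_norm d s = 1"
  shows "(l2_dist d (\<lambda>i. c i + r * u i) (\<lambda>i. c i + \<rho> * s i))\<^sup>2 =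
    (r - \<rho>)\<^sup>2 + r * \<rho> * (l2_dist d u s)\<^sup>2"
proof -
  have "(\<Sum>i<d. (u i)\<^sup>2) = 1" "(\<Sum>i<d. (s i)\<^sup>2) = 1"
    using assms by (simp_all flip: l2_norm_square)
  \<comment> \<open>The mixed product of \<open>u i\<close> and \<open>s i\<close> is rewritten
    through \<open>(u i - s i)^2\<close>; the sums of \<open>(u i)^2\<close> and
    \<open>(s i)^2\<close> that remain are 1, and their coefficients add up to
    \<open>(r - \<rho>)^2\<close>.\<close>
  moreover have "(\<Sum>i<d. ((c i + r * u i) - (c i + \<rho> * s i))\<^sup>2) =
    (\<Sum>i<d. (r\<^sup>2 - r * \<rho>) * (u i)\<^sup>2 + (\<rho>\<^sup>2 - r * \<rho>) * (s i)\<^sup>2 + r * \<rho> * (u i - s i)\<^sup>2)"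
    by (rule sum.cong) (auto simp: power2_eq_square algebra_simps)
  ultimately show ?thesis
    unfolding l2_dist_square
    by (simp add: sum.distrib flip: sum_distrib_left) (simp add: power2_eq_square algebra_simps)
qed

lemma polar_decomposition:
  assumes "x \<in> Rn d" "c \<in> Rn d" "l2_dist d x c > 0"
  obtains u where "u \<in> unit_sphere d" "x = (\<lambda>i. c i + l2_dist d x c * u i)"
proof
  let ?r = "l2_dist d x c"
  let ?u = "\<lambda>i. (x i - c i) / ?r"
  have "(l2_norm d ?u)\<^sup>2 = (\<Sum>i<d. (x i - c i)\<^sup>2) / ?r\<^sup>2"
    by (simp add: l2_norm_square power_divide sum_divide_distrib)
  also have "\<dots> = 1"
    using assms(3) by (simp flip: l2_dist_square)
  finally have "l2_norm d ?u = 1"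
    by (simp add: power2_eq_1_iff l2_norm_def) (smt (verit) L2_set_nonneg)
  then show "?u \<in> unit_sphere d"
    using assms by (simp add: unit_sphere_def in_Rn_iff)
  show "x = (\<lambda>i. c i + ?r * ?u i)"
    using assms(3) by auto
qed

section \<open>The k-means cost and its optimum\<close>

lemma nearest_center:
  assumes "finite C" "C \<noteq> {}"
  obtains f where "\<And>x. f x \<in> C" "\<And>x. Min ((\<lambda>c. (l2_dist d x c)\<^sup>2) ` C) = (l2_dist d x (f x))\<^sup>2"
proof -
  have "\<exists>c\<in>C. Min ((\<lambda>c. (l2_dist d x c)\<^sup>2) ` C) = (l2_dist d x c)\<^sup>2" for x
  proof -
    have "Min ((\<lambda>c. (l2_dist d x c)\<^sup>2) ` C) \<in> (\<lambda>c. (l2_dist d x c)\<^sup>2) ` C"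
      using assms by (intro Min_in) auto
    then show ?thesis
      by blast
  qed
  then show thesis
    using that by metis
qed

text \<open>An upper bound on the cost needs only one adequate center per point, not the nearest
  one.\<close>

lemma kmeans_cost_le:
  assumes "finite C" "\<And>x. x \<in> X \<Longrightarrow> \<exists>c\<in>C. (l2_dist d x c)\<^sup>2 \<le> b x"
  shows "kmeans_cost d C X \<le> sum b X"
  unfolding kmeans_cost_def
proof (rule sum_mono)
  fix x assume "x \<in> X"
  then obtain c where "c \<in> C" "(l2_dist d x c)\<^sup>2 \<le> b x"
    using assms(2) by blast
  then show "Min ((\<lambda>c. (l2_dist d x c)\<^sup>2) ` C) \<le> b x"
    using assms(1) by (intro Min.coboundedI[THEN order_trans, of _ "(l2_dist d x c)\<^sup>2"]) auto
qed

lemma kmeans_cost_nonneg: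
  assumes "finite C" "C \<noteq> {}"
  shows "kmeans_cost d C X \<ge> 0"
  unfolding kmeans_cost_def using assms by (intro sum_nonneg) simp

lemma kmeans_cost_self:
  assumes "finite X"
  shows "kmeans_cost d X X \<le> 0"
  using kmeans_cost_le[OF assms, of X d "\<lambda>_. 0"] by (force simp: l2_dist_square)

text \<open>Over the reals, \<open>Inf\<close> is governed by lower bounds only for nonempty sets;
  for \<open>d \<ge> 1\<close> the space is infinite and has subsets of every size
  \<open>k\<close>.\<close>

lemma kmeans_costs_nonempty:
  assumes "d \<ge> 1"
  shows "{kmeans_cost d C X | C. C \<subseteq> Rn d \<and> finite C \<and> card C = k} \<noteq> {}"
  using infinite_arbitrarily_large[OF infinite_Rn[OF assms], of k] by blast

lemma opt_kmeans_cost_ge: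
  assumes "d \<ge> 1" "\<And>C. C \<subseteq> Rn d \<Longrightarrow> finite C \<Longrightarrow> card C = k \<Longrightarrow> m \<le> kmeans_cost d C X"
  shows "m \<le> opt_kmeans_cost d k X"
  unfolding opt_kmeans_cost_def
  using assms(2) by (intro cInf_greatest kmeans_costs_nonempty assms(1)) blast

lemma opt_kmeans_cost_nonneg:
  assumes "d \<ge> 1" "k \<ge> 1"
  shows "opt_kmeans_cost d k X \<ge> 0"
  using assms by (intro opt_kmeans_cost_ge kmeans_cost_nonneg) auto

text \<open>By pigeonhole, two distinct points share a nearest center, and the triangle inequality
  with \<open>(a + b)^2 \<le> 2 * (a^2 + b^2)\<close> makes the cost at least half their squared
  distance. Minimizing over the finitely many pairs gives a bound uniform in \<open>C\<close>, as an
  infimum requires.\<close>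

lemma opt_kmeans_cost_pos:
  assumes "d \<ge> 1" "k \<ge> 1" "X \<subseteq> Rn d" "finite X" "k < card X"
  shows "opt_kmeans_cost d k X > 0"
proof -
  interpret Metric_space "Rn d" "l2_dist d"
    by (rule Metric_space_l2_dist)
  define P where "P = {(x, y) \<in> X \<times> X. x \<noteq> y}"
  \<comment> \<open>The inserted 1 makes the set visibly nonempty, so that \<open>Min\<close> is
    determined; any positive number would do.\<close>
  define m where "m = Min (insert 1 ((\<lambda>(x, y). (l2_dist d x y)\<^sup>2 / 2) ` P))"
  have finP: "finite P"
    using assms(4) by (intro finite_subset[of P "X \<times> X"]) (auto simp: P_def)
  have "0 < l2_dist d x y" if "(x, y) \<in> P" for x y
  proof (rule mdist_pos_less)
    show "x \<noteq> y" "x \<in> Rn d" "y \<in> Rn d"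
      using that subsetD[OF assms(3)] by (simp_all add: P_def)
  qed
  then have "m > 0"
    unfolding m_def using finP by (subst Min_gr_iff) fastforce+
  moreover have "m \<le> kmeans_cost d C X" if C: "C \<subseteq> Rn d" "finite C" "card C = k" for C
  proof -
    have "C \<noteq> {}"
      using C assms(2) by auto
    then obtain f where f: "\<And>x. f x \<in> C"
      "\<And>x. Min ((\<lambda>c. (l2_dist d x c)\<^sup>2) ` C) = (l2_dist d x (f x))\<^sup>2"
      using nearest_center[OF C(2)] by blast
    have "\<not> inj_on f X"
      using card_inj_on_le[of f X C] f(1) C assms(5) by auto
    then obtain x y where xy: "x \<in> X" "y \<in> X" "x \<noteq> y" "f x = f y"
      by (auto simp: inj_on_def)
    let ?a = "l2_dist d x (f x)" and ?b = "l2_dist d y (f y)"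
    have "l2_dist d x y \<le> ?a + ?b"
      using triangle[of x "f x" y] xy f(1) C(1) assms(3) commute[of "f x" y] by auto
    then have "(l2_dist d x y)\<^sup>2 \<le> (?a + ?b)\<^sup>2"
      by (intro power_mono) (auto simp: l2_dist_nonneg)
    also have "\<dots> \<le> 2 * (?a\<^sup>2 + ?b\<^sup>2)"
      using sum_squares_bound[of ?a ?b] by (simp add: power2_sum)
    finally have "(l2_dist d x y)\<^sup>2 / 2 \<le> ?a\<^sup>2 + ?b\<^sup>2"
      by simp
    also have "\<dots> = (\<Sum>z\<in>{x, y}. (l2_dist d z (f z))\<^sup>2)"
      using xy by simp
    also have "\<dots> \<le> (\<Sum>z\<in>X. (l2_dist d z (f z))\<^sup>2)"
      using xy assms(4) by (intro sum_mono2) auto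
    also have "\<dots> = kmeans_cost d C X"
      by (simp add: kmeans_cost_def f(2))
    finally have "(l2_dist d x y)\<^sup>2 / 2 \<le> kmeans_cost d C X" .
    moreover have "m \<le> (l2_dist d x y)\<^sup>2 / 2"
      unfolding m_def using finP xy by (intro Min.coboundedI) (auto simp: P_def image_iff)
    ultimately show ?thesis
      by linarith
  qed
  ultimately show ?thesis
    using opt_kmeans_cost_ge[OF assms(1)] by (meson less_le_trans)
qed

lemma near_optimal_centers:
  assumes "d \<ge> 1" "opt_kmeans_cost d k X < a"
  obtains C where "C \<subseteq> Rn d" "finite C" "card C = k" "kmeans_cost d C X < a"
  using cInf_lessD[OF kmeans_costs_nonempty[OF assms(1)]] assms(2)
  unfolding opt_kmeans_cost_def by blast

section \<open>Geometric growth of the radii\<close>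

lemma geometric_bracket:
  fixes b r R :: real
  assumes "b > 1" "0 < R" "R \<le> r"
  obtains j where "R * b ^ j \<le> r" "r < R * b ^ Suc j"
proof -
  obtain m where "r / R < b ^ m"
    using real_arch_pow[OF assms(1)] by blast
  then have ex: "\<exists>m. r < R * b ^ m"
    using assms(2) by (auto simp: field_simps)
  define m where "m = (LEAST m. r < R * b ^ m)"
  have m: "r < R * b ^ m"
    unfolding m_def using ex by (rule LeastI_ex)
  \<comment> \<open>Since \<open>R \<le> r\<close>, the least exponent exceeding \<open>r\<close> is
    not 0; by minimality its predecessor gives the lower half of the bracket.\<close>
  with assms(3) have "m \<noteq> 0"
    by (metis mult.right_neutral not_less power_0)
  then obtain j where j: "m = Suc j"
    using not0_implies_Suc by blast
  have "\<not> r < R * b ^ j"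
    using not_less_Least[of j "\<lambda>m. r < R * b ^ m"] j m_def by simp
  then show thesis
    using that[of j] m j by simp
qed

text \<open>For \<open>\<delta> \<le> 1 / 2\<close>, \<open>ln (1 + \<delta>) \<ge> \<delta> -
  \<delta>^2 \<ge> \<delta> / 2\<close>. This is where the factor \<open>1 / sqrt \<epsilon>\<close>
  in the number of radii comes from.\<close>

lemma power_exponent_bound:
  fixes \<delta> x :: real
  assumes "0 < \<delta>" "\<delta> \<le> 1 / 2" "x > 0" "(1 + \<delta>) ^ j \<le> x"
  shows "real j \<le> 2 * ln x / \<delta>"
proof -
  have "\<delta> / 2 \<le> \<delta> - \<delta>\<^sup>2"
    using mult_left_mono[OF assms(2), of \<delta>] assms(1) by (simp add: power2_eq_square)
  also have "\<dots> \<le> ln (1 + \<delta>)"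
    using assms(1,2) by (intro ln_one_plus_pos_lower_bound) auto
  finally have "real j * (\<delta> / 2) \<le> real j * ln (1 + \<delta>)"
    by (intro mult_left_mono) auto
  also have "\<dots> = ln ((1 + \<delta>) ^ j)"
    using assms(1) by (simp add: ln_realpow)
  also have "\<dots> \<le> ln x"
    using assms by (intro ln_mono) auto
  finally show ?thesis
    using assms(1) by (simp add: field_simps)
qed

section \<open>Construction of the centers\<close>

text \<open>The radial error contributes \<open>\<epsilon> / 9\<close> and the angular error
  \<open>\<epsilon> / 2\<close>, both relative to the squared distance to \<open>c\<close>; the
  total 11/18 is rounded up to 5/8.\<close>

lemma covering_point_error:
  assumes S: "covering_set (unit_sphere d) (l2_dist d) (sqrt (\<epsilon> / 2)) S"
    and x: "x \<in> Rn d" "c \<in> Rn d"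
    and \<rho>: "0 < \<rho>" "\<rho> \<le> l2_dist d x c" "l2_dist d x c - \<rho> \<le> sqrt \<epsilon> / 3 * \<rho>"
    and "0 < \<epsilon>"
  shows "\<exists>s\<in>S. (l2_dist d x (\<lambda>i. c i + \<rho> * s i))\<^sup>2 \<le> 5 / 8 * \<epsilon> * (l2_dist d x c)\<^sup>2"
proof -
  define r where "r = l2_dist d x c"
  have r: "0 < r" "\<rho> \<le> r" "r - \<rho> \<le> sqrt \<epsilon> / 3 * \<rho>"
    using \<rho> by (auto simp: r_def)
  obtain u where u: "u \<in> unit_sphere d" "x = (\<lambda>i. c i + r * u i)"
    using polar_decomposition[OF x] r(1) unfolding r_def by blast
  obtain s where s: "s \<in> S" "l2_dist d u s \<le> sqrt (\<epsilon> / 2)"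
    using S u(1) unfolding covering_set_def by blast
  have "s \<in> unit_sphere d"
    using S s(1) unfolding covering_set_def by blast
  then have "(l2_dist d x (\<lambda>i. c i + \<rho> * s i))\<^sup>2 = (r - \<rho>)\<^sup>2 + r * \<rho> * (l2_dist d u s)\<^sup>2"
    using u(1) unfolding u(2) by (intro l2_dist_scaled_square) (auto simp: unit_sphere_def)
  also have "(r - \<rho>)\<^sup>2 \<le> (sqrt \<epsilon> / 3 * r)\<^sup>2"
  proof (rule power_mono)
    have "sqrt \<epsilon> / 3 * \<rho> \<le> sqrt \<epsilon> / 3 * r"
      using r(2) \<open>0 < \<epsilon>\<close> by (intro mult_left_mono) auto
    then show "r - \<rho> \<le> sqrt \<epsilon> / 3 * r"
      using r(3) by linarith
  qed (use r(2) in simp)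
  also have "\<dots> = \<epsilon> / 9 * r\<^sup>2"
    using \<open>0 < \<epsilon>\<close> by (simp add: power_mult_distrib power_divide)
  also have "r * \<rho> * (l2_dist d u s)\<^sup>2 \<le> r * r * (sqrt (\<epsilon> / 2))\<^sup>2"
    using r \<rho>(1) s(2) by (intro mult_mono power_mono) (auto simp: l2_dist_nonneg)
  also have "\<dots> = \<epsilon> / 2 * r\<^sup>2"
    using \<open>0 < \<epsilon>\<close> by (simp add: power2_eq_square)
  also have "\<epsilon> / 9 * r\<^sup>2 + \<epsilon> / 2 * r\<^sup>2 \<le> 5 / 8 * \<epsilon> * r\<^sup>2"
    using mult_nonneg_nonneg[of \<epsilon> "r\<^sup>2"] \<open>0 < \<epsilon>\<close> by simp
  finally show ?thesis
    using s(1) by (auto simp: r_def)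
qed

text \<open>The main case: \<open>k < card X\<close> makes the optimum, and with it the innermost
  radius, positive, while the lower bound on \<open>\<epsilon>\<close> keeps the number of radii
  logarithmic in \<open>card X\<close>.\<close>

lemma exists_small_cost_centers:
  assumes d: "d \<ge> 1" and \<epsilon>: "0 < \<epsilon>" "\<epsilon> \<le> 1" and k: "k \<ge> 1"
    and X: "X \<subseteq> Rn d" "finite X" "k < card X" "1 / (real (card X))\<^sup>2 < \<epsilon>"
    and S: "finite S" "S \<noteq> {}" "covering_set (unit_sphere d) (l2_dist d) (sqrt (\<epsilon> / 2)) S"
  shows "\<exists>\<xi>. \<xi> \<subseteq> Rn d \<and> finite \<xi> \<and> \<xi> \<noteq> {} \<and>
    real (card \<xi>) \<le> real (card S) * real k * (18 * ln (real (card X)) / sqrt \<epsilon> + 2) \<and>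
    kmeans_cost d \<xi> X \<le> \<epsilon> * opt_kmeans_cost d k X"
proof -
  define n where "n = real (card X)"
  define \<Delta> where "\<Delta> = opt_kmeans_cost d k X"
  have n: "n \<ge> 2" "1 / n\<^sup>2 < \<epsilon>"
    using X k by (auto simp: n_def)
  have \<Delta>: "\<Delta> > 0"
    unfolding \<Delta>_def using opt_kmeans_cost_pos[OF d k X(1-3)] .
  then obtain C where C: "C \<subseteq> Rn d" "finite C" "card C = k" "kmeans_cost d C X < 6 / 5 * \<Delta>"
    using near_optimal_centers[OF d, of k X "6 / 5 * \<Delta>"] \<Delta>_def by auto
  have C0: "C \<noteq> {}"
    using C k by auto
  then obtain f where f: "\<And>x. f x \<in> C"
    "\<And>x. Min ((\<lambda>c. (l2_dist d x c)\<^sup>2) ` C) = (l2_dist d x (f x))\<^sup>2"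
    using nearest_center[OF C(2)] by blast
  define r where "r x = l2_dist d x (f x)" for x
  have cost: "(\<Sum>x\<in>X. (r x)\<^sup>2) < 6 / 5 * \<Delta>"
    using C(4) by (simp add: kmeans_cost_def f(2) r_def)
  define R where "R = sqrt (\<epsilon> * \<Delta> / (4 * n))"
  have R: "R > 0" "R\<^sup>2 = \<epsilon> * \<Delta> / (4 * n)"
    using \<epsilon> \<Delta> n by (auto simp: R_def)
  define \<delta> where "\<delta> = sqrt \<epsilon> / 3"
  have \<delta>: "0 < \<delta>" "\<delta> \<le> 1 / 2"
    using \<epsilon> real_sqrt_le_1_iff[of \<epsilon>] unfolding \<delta>_def by (auto simp del: real_sqrt_le_1_iff)
  define J where "J = nat \<lfloor>18 * ln n / sqrt \<epsilon>\<rfloor>"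
  have J: "j \<le> J" if j: "x \<in> X" "R * (1 + \<delta>) ^ j \<le> r x" for j x
  proof -
    have "(r x)\<^sup>2 \<le> (\<Sum>x\<in>X. (r x)\<^sup>2)"
      using j(1) X(2) by (intro member_le_sum) auto
    then have rx: "(r x)\<^sup>2 \<le> 6 / 5 * \<Delta>"
      using cost by linarith
    have "R\<^sup>2 * ((1 + \<delta>) ^ j)\<^sup>2 \<le> (r x)\<^sup>2"
      using j(2) R(1) \<delta>(1) by (simp flip: power_mult_distrib add: power_mono)
    also note rx
    also have "6 / 5 * \<Delta> = R\<^sup>2 * (24 / 5 * n * (1 / \<epsilon>))"
      using R(2) \<epsilon> n by (simp add: field_simps)
    finally have "((1 + \<delta>) ^ j)\<^sup>2 \<le> 24 / 5 * n * (1 / \<epsilon>)"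
      using R(1) by (simp only: mult_le_cancel_left_pos zero_less_power)
    \<comment> \<open>Here \<open>24 / 5 \<le> 8 \<le> n^3\<close> and
      \<open>1 / \<epsilon> \<le> n^2\<close>, so the product is at most the square of
      \<open>n^3\<close>. The exponent 3 and \<open>\<delta> = sqrt \<epsilon> / 3\<close> then
      yield the constant 18 = 2 * 3 * 3.\<close>
    also have "\<dots> \<le> n ^ 3 * n * n\<^sup>2"
    proof (intro mult_mono)
      show "24 / 5 \<le> n ^ 3"
        using power_mono[OF n(1), of 3] by simp
      show "1 / \<epsilon> \<le> n\<^sup>2"
        using n \<epsilon> by (simp add: field_simps)
    qed (use n \<epsilon> in auto)
    also have "\<dots> = (n ^ 3)\<^sup>2"
      by (simp add: power2_eq_square power3_eq_cube)
    finally have "(1 + \<delta>) ^ j \<le> n ^ 3"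
      by (rule power2_le_imp_le) (use n in simp)
    then have "real j \<le> 2 * ln (n ^ 3) / \<delta>"
      using n by (intro power_exponent_bound[OF \<delta>]) auto
    also have "\<dots> = 18 * ln n / sqrt \<epsilon>"
      using n by (simp add: ln_realpow \<delta>_def)
    finally show ?thesis
      unfolding J_def by linarith
  qed
  define h where "h = (\<lambda>((c, s), j::nat) i::nat. c i + R * (1 + \<delta>) ^ j * s i)"
  \<comment> \<open>\<open>C\<close> itself is kept to serve the points closer than \<open>R\<close>
    to their center.\<close>
  define \<xi> where "\<xi> = C \<union> h ` ((C \<times> S) \<times> {..J})"
  have fin: "finite \<xi>"
    using C S by (auto simp: \<xi>_def)
  have "card \<xi> \<le> card C + card ((C \<times> S) \<times> {..J})"
    unfolding \<xi>_def using C S by (intro card_Un_le[THEN order_trans] add_left_mono card_image_le) auto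
  also have "\<dots> = k * 1 + k * card S * (J + 1)"
    by (simp add: card_cartesian_product C)
  \<comment> \<open>As \<open>S\<close> is nonempty, \<open>C\<close> is counted as one more layer
    of size \<open>k * card S\<close>; with exponent 0 included, this makes \<open>J + 2\<close>
    layers.\<close>
  also have "\<dots> \<le> k * card S + k * card S * (J + 1)"
    using S by (intro add_right_mono mult_left_mono) (auto simp: Suc_le_eq card_gt_0_iff)
  finally have "real (card \<xi>) \<le> real (k * card S + k * card S * (J + 1))"
    by (simp only: of_nat_le_iff)
  also have "\<dots> = real (card S) * real k * (real J + 2)"
    by (simp add: algebra_simps)
  also have "\<dots> \<le> real (card S) * real k * (18 * ln n / sqrt \<epsilon> + 2)"
    using n \<epsilon> unfolding J_def by (intro mult_left_mono add_right_mono) auto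
  finally have card: "real (card \<xi>) \<le> real (card S) * real k * (18 * ln n / sqrt \<epsilon> + 2)" .
  have sub: "\<xi> \<subseteq> Rn d"
    using C(1) S(3) by (fastforce simp: \<xi>_def h_def covering_set_def unit_sphere_def in_Rn_iff subset_iff)
  have "kmeans_cost d \<xi> X \<le> (\<Sum>x\<in>X. R\<^sup>2 + 5 / 8 * \<epsilon> * (r x)\<^sup>2)"
  proof (rule kmeans_cost_le[OF fin])
    fix x assume x: "x \<in> X"
    show "\<exists>c\<in>\<xi>. (l2_dist d x c)\<^sup>2 \<le> R\<^sup>2 + 5 / 8 * \<epsilon> * (r x)\<^sup>2"
    proof (cases "R \<le> r x")
      case True
      have "1 + \<delta> > 1"
        using \<delta> by simp
      then obtain j where j: "R * (1 + \<delta>) ^ j \<le> r x" "r x < R * (1 + \<delta>) ^ Suc j"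
        using geometric_bracket[OF _ R(1) True] by blast
      have "0 < R * (1 + \<delta>) ^ j"
        using R(1) \<delta>(1) by simp
      \<comment> \<open>The bracket says exactly that \<open>r x\<close> exceeds the chosen radius
        by less than \<open>\<delta>\<close> times that radius.\<close>
      then have "\<exists>s\<in>S. (l2_dist d x (\<lambda>i. f x i + R * (1 + \<delta>) ^ j * s i))\<^sup>2 \<le> 5 / 8 * \<epsilon> * (l2_dist d x (f x))\<^sup>2"
        using j x X(1) C(1) f(1)[of x] \<epsilon>(1)
        by (intro covering_point_error[OF S(3)]) (auto simp: r_def \<delta>_def algebra_simps)
      then obtain s where s: "s \<in> S" "(l2_dist d x (h ((f x, s), j)))\<^sup>2 \<le> 5 / 8 * \<epsilon> * (r x)\<^sup>2"
        by (auto simp: h_def r_def)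
      have "h ((f x, s), j) \<in> \<xi>"
        unfolding \<xi>_def using s(1) f(1) J[OF x j(1)] by blast
      moreover have "(l2_dist d x (h ((f x, s), j)))\<^sup>2 \<le> R\<^sup>2 + 5 / 8 * \<epsilon> * (r x)\<^sup>2"
        using s(2) zero_le_power2[of R] by linarith
      ultimately show ?thesis
        by blast
    next
      case False
      then have "(r x)\<^sup>2 \<le> R\<^sup>2"
        by (intro power_mono) (auto simp: r_def l2_dist_nonneg)
      moreover have "0 \<le> 5 / 8 * \<epsilon> * (r x)\<^sup>2"
        using \<epsilon> by simp
      ultimately have "(l2_dist d x (f x))\<^sup>2 \<le> R\<^sup>2 + 5 / 8 * \<epsilon> * (r x)\<^sup>2"
        by (simp add: r_def)
      then show ?thesis
        using f(1) by (auto simp: \<xi>_def)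
    qed
  qed
  also have "\<dots> = n * R\<^sup>2 + 5 / 8 * \<epsilon> * (\<Sum>x\<in>X. (r x)\<^sup>2)"
    by (simp only: sum.distrib sum_constant sum_distrib_left n_def)
  also have "\<dots> \<le> n * R\<^sup>2 + 5 / 8 * \<epsilon> * (6 / 5 * \<Delta>)"
    using cost \<epsilon> by (intro add_left_mono mult_left_mono) auto
  \<comment> \<open>The near points account for 1/4, and the others for 5/8 * 6/5 = 3/4.\<close>
  also have "\<dots> = \<epsilon> * \<Delta>"
    using R(2) n by simp
  finally show ?thesis
    using fin card sub C0 unfolding \<Delta>_def n_def by (intro exI[of _ \<xi>]) (auto simp: \<xi>_def)
qed

theorem theorem7:
  shows "\<exists>K::real. K > 0 \<and>
    (\<forall>(d::nat) (\<epsilon>::real) (k::nat) (n::nat) (X :: (nat \<Rightarrow> real) set).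
      d \<ge> 1 \<longrightarrow> 0 < \<epsilon> \<longrightarrow> \<epsilon> \<le> 1 \<longrightarrow> k \<ge> 1 \<longrightarrow>
      X \<subseteq> Rn d \<longrightarrow> finite X \<longrightarrow> card X = n \<longrightarrow> n \<ge> 2 \<longrightarrow>
      (\<exists>\<xi>. \<xi> \<subseteq> Rn d \<and> finite \<xi> \<and> \<xi> \<noteq> {} \<and>
        real (card \<xi>) \<le>
          K * (real (covering_number (unit_sphere d) (l2_dist d) (sqrt (\<epsilon> / 2)))
               * real k * ln (real n) / sqrt \<epsilon>) \<and>
        kmeans_cost d \<xi> X \<le> \<epsilon> * opt_kmeans_cost d k X))"
proof (rule exI[of _ 22], intro conjI allI impI)
  show "(22::real) > 0"
    by simp
next
  fix d k n :: nat and \<epsilon> :: real and X :: "(nat \<Rightarrow> real) set"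
  assume d: "d \<ge> 1" and \<epsilon>: "0 < \<epsilon>" "\<epsilon> \<le> 1" and k: "k \<ge> 1"
    and X: "X \<subseteq> Rn d" "finite X" "card X = n" and n: "n \<ge> 2"
  define N where "N = covering_number (unit_sphere d) (l2_dist d) (sqrt (\<epsilon> / 2))"
  have "sqrt (\<epsilon> / 2) > 0"
    using \<epsilon> by simp
  then obtain S where S: "finite S" "covering_set (unit_sphere d) (l2_dist d) (sqrt (\<epsilon> / 2)) S" "card S = N"
    using finite_covering_unit_sphere covering_number_attained unfolding N_def by metis
  have S0: "S \<noteq> {}"
    using S(2) unit_sphere_nonempty[OF d] unfolding covering_set_def by blast
  then have N: "N \<ge> 1"
    using S by (auto simp: Suc_le_eq card_gt_0_iff)
  have ln: "ln (real n) \<ge> 1 / 2"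
    using ln_mono[of 2 "real n"] n ln2_ge_two_thirds by linarith
  have Nk: "real N * real k \<ge> 1"
    using mult_mono[of 1 "real N" 1 "real k"] N k by simp
  have sq: "1 \<le> 1 / sqrt \<epsilon>"
    using \<epsilon> by simp
  have big: "1 / 2 * (1 / sqrt \<epsilon>) \<le> ln (real n) / sqrt \<epsilon>"
    using mult_right_mono[OF ln, of "1 / sqrt \<epsilon>"] \<epsilon>(1) by simp
  show "\<exists>\<xi>. \<xi> \<subseteq> Rn d \<and> finite \<xi> \<and> \<xi> \<noteq> {} \<and>
        real (card \<xi>) \<le>
          22 * (real (covering_number (unit_sphere d) (l2_dist d) (sqrt (\<epsilon> / 2)))
               * real k * ln (real n) / sqrt \<epsilon>) \<and>
        kmeans_cost d \<xi> X \<le> \<epsilon> * opt_kmeans_cost d k X"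
  proof (cases "n \<le> k \<or> \<epsilon> \<le> 1 / (real n)\<^sup>2")
    case True
    \<comment> \<open>Either \<open>n \<le> k\<close> and the other two factors are at least 1, or
      \<open>n \<le> 1 / sqrt \<epsilon>\<close> and \<open>N * k \<ge> 1\<close>.\<close>
    have "real n \<le> real N * real k * (1 / sqrt \<epsilon>)"
    proof (cases "n \<le> k")
      case True
      then have "real n \<le> 1 * real k * 1"
        by simp
      also have "\<dots> \<le> real N * real k * (1 / sqrt \<epsilon>)"
        using N sq by (intro mult_mono) auto
      finally show ?thesis .
    next
      case False
      then have "sqrt \<epsilon> \<le> sqrt (1 / (real n)\<^sup>2)"
        using True by simp
      then have "real n \<le> 1 / sqrt \<epsilon>"
        using n \<epsilon> by (simp add: real_sqrt_divide field_simps)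
      then show ?thesis
        using mult_right_mono[OF Nk, of "1 / sqrt \<epsilon>"] sq by linarith
    qed
    also have "\<dots> = 2 * (real N * real k * (1 / 2 * (1 / sqrt \<epsilon>)))"
      by simp
    also have "\<dots> \<le> 22 * (real N * real k * (ln (real n) / sqrt \<epsilon>))"
      using big ln \<epsilon>(1) by (intro mult_mono) auto
    finally have "real (card X) \<le> 22 * (real N * real k * ln (real n) / sqrt \<epsilon>)"
      using X by simp
    \<comment> \<open>Zero cost meets the bound even when the optimum is 0.\<close>
    moreover have "kmeans_cost d X X \<le> \<epsilon> * opt_kmeans_cost d k X"
      using kmeans_cost_self[OF X(2), of d] opt_kmeans_cost_nonneg[OF d k, of X] \<epsilon>
      by (meson less_imp_le mult_nonneg_nonneg order_trans)
    ultimately show ?thesis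
      using X n unfolding N_def by (intro exI[of _ X]) auto
  next
    case False
    then have "k < card X" "1 / (real (card X))\<^sup>2 < \<epsilon>"
      using X by auto
    from exists_small_cost_centers[OF d \<epsilon> k X(1,2) this S(1) S0 S(2)]
    obtain \<xi> where \<xi>: "\<xi> \<subseteq> Rn d" "finite \<xi>" "\<xi> \<noteq> {}"
      "real (card \<xi>) \<le> real N * real k * (18 * ln (real n) / sqrt \<epsilon> + 2)"
      "kmeans_cost d \<xi> X \<le> \<epsilon> * opt_kmeans_cost d k X"
      unfolding S(3) X(3) by blast
    \<comment> \<open>The constant is 22 = 18 + 4: since \<open>ln n \<ge> 1 / 2\<close> and
      \<open>sqrt \<epsilon> \<le> 1\<close>, the summand 2 is at most
      \<open>4 * ln n / sqrt \<epsilon>\<close>.\<close>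
    have "18 * ln (real n) / sqrt \<epsilon> + 2 \<le> 22 * (ln (real n) / sqrt \<epsilon>)"
      using big sq by simp
    then have "real N * real k * (18 * ln (real n) / sqrt \<epsilon> + 2)
      \<le> real N * real k * (22 * (ln (real n) / sqrt \<epsilon>))"
      by (intro mult_left_mono) auto
    then have "real (card \<xi>) \<le> 22 * (real N * real k * ln (real n) / sqrt \<epsilon>)"
      using \<xi>(4) by (simp add: mult_ac)
    then show ?thesis
      using \<xi> unfolding N_def by blast
  qed
qed

end
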